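(* Let $m\ge 1$ and let $n_1, \ldots, n_m \geq 2$ be even integers, and let $M$ be the complement of a $(2 ; n_1, \ldots, n_m)$ circulant block diagonal matrix. Put $n = \sum_{i=1}^{m}{n_i}$, and suppose that $n_i >2$ for some $i \in [m]$. Then $\mathrm{rank}_{\mathrm{bin}}(M) = n-m+1$.
   Context: For integers $n \ge k \ge 0$, $D_{n,k}$ denotes the $n\times n$ circulant $0,1$ matrix whose first row consists of $n-k$ ones followed by $k$ zeros, each subsequent row being the cyclic shift of the previous row by one position to the right. For integers $n_i\ge 2$, a $(2;n_1,\ldots,n_m)$ circulant block diagonal matrix is a block matrix with $m$ diagonal blocks whose $i$th diagonal block is $D_{n_i,n_i-2}$ (first row: two ones followed by $n_i-2$ zeros) and all of whose other entries are zero. The complement of a $0,1$ matrix is obtained by swapping zeros and ones. The binary rank $\mathrm{rank}_{\mathrm{bin}}(A)$ is the smallest number of combinatorial rectangles (all-one submatrices indexed by a set of rows times a set of columns) that partition the ones of $A$. *)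

theory Defs
  imports "Jordan_Normal_Form.Matrix" "HOL-Library.Disjoint_Sets"
begin

text \<open>Rows and columns are indexed from 0. Shifting the first row cyclically to the right by
  \<open>i\<close> places makes entry \<open>(i, j)\<close> equal to entry \<open>(0, (j - i) mod n)\<close>.\<close>

definition circulant_D :: "nat \<Rightarrow> nat \<Rightarrow> int mat" where
  "circulant_D n k = mat n n (\<lambda>(i, j). if (int j - int i) mod int n < int n - int k then 1 else 0)"

definition circulant_block_diag :: "nat list \<Rightarrow> int mat" where
  "circulant_block_diag ns = diag_block_mat (map (\<lambda>n. circulant_D n (n - 2)) ns)"

definition complement_mat :: "int mat \<Rightarrow> int mat" where
  "complement_mat A = map_mat (\<lambda>x. 1 - x) A"

definition ones :: "int mat \<Rightarrow> (nat \<times> nat) set" where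
  "ones A = {(i, j). i < dim_row A \<and> j < dim_col A \<and> A $$ (i, j) = 1}"

definition comb_rectangle :: "int mat \<Rightarrow> (nat \<times> nat) set \<Rightarrow> bool" where
  "comb_rectangle A S \<longleftrightarrow> (\<exists>R C. S = R \<times> C \<and> R \<subseteq> {..<dim_row A} \<and> C \<subseteq> {..<dim_col A} \<and>
     (\<forall>i\<in>R. \<forall>j\<in>C. A $$ (i, j) = 1))"

text \<open>The library notion of a partition excludes empty parts; this does not affect the minimum.\<close>

definition binary_rank :: "int mat \<Rightarrow> nat" where
  "binary_rank A = (LEAST r. \<exists>P. finite P \<and> card P = r \<and> partition_on (ones A) P \<and>
     (\<forall>S\<in>P. comb_rectangle A S))"

end

theory Submission
  imports Defs "Jordan_Normal_Form.Determinant"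
begin

text \<open>Upper bound: within a block, row \<open>i\<close> of \<open>M\<close> splits into the columns of the parity of \<open>i\<close>
  other than \<open>i\<close> and the columns of the opposite parity other than the cyclic successor of \<open>i\<close>.
  Extending these sets suitably outside the block lets each serve two rows, and the ones belonging
  to the first indices of the blocks coincide.

  Lower bound: the real rank of \<open>M\<close> is \<open>n - m\<close>. If \<open>n - m\<close> rectangles \<open>R\<^sub>t \<times> C\<^sub>t\<close> sufficed, the
  factorization \<open>M = X Y\<close> would have full rank, so \<open>Y G X = I\<close> for a generalized inverse \<open>G\<close> of
  \<open>M\<close>. One such \<open>G\<close> is an integer matrix plus \<open>1 / (n / 2 - 1)\<close> times the indicator of pairs of
  even indices; the diagonal of \<open>Y G X\<close> thus shows that \<open>n / 2 - 1\<close> divides \<open>a\<^sub>t b\<^sub>t\<close>, where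
  \<open>a\<^sub>t\<close> and \<open>b\<^sub>t\<close> count the even elements of \<open>R\<^sub>t\<close> and \<open>C\<^sub>t\<close>. The alternating vector is in the left
  and right kernels of \<open>M\<close>, so \<open>R\<^sub>t\<close> and \<open>C\<^sub>t\<close> contain as many even as odd elements, whence
  \<open>a\<^sub>t b\<^sub>t > 0\<close>. As \<open>M\<close> has \<open>n / 2 (n / 2 - 1)\<close> ones with both indices even, \<open>n - m \<le> n / 2\<close>,
  so all blocks would have size \<open>2\<close>.\<close>

section \<open>One-sided inverses and parity sums\<close>

declare sum_of_bool_eq [simp del] sum_mult_of_bool_eq [simp del] sum_of_bool_mult_eq [simp del]

text \<open>Enumerating \<open>I\<close> by \<open>{..<r}\<close> turns \<open>A\<close> and
  \<open>B\<close> into square matrices, and over a field a right inverse of a square matrix is also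
  a left inverse.\<close>

lemma sum_left_right_inverse:
  fixes A :: "'a \<Rightarrow> nat \<Rightarrow> 'c::field" and B :: "nat \<Rightarrow> 'a \<Rightarrow> 'c"
  assumes fin: "finite I" and card: "card I = r"
    and inv: "\<And>i i'. i \<in> I \<Longrightarrow> i' \<in> I \<Longrightarrow> (\<Sum>t<r. A i t * B t i') = of_bool (i = i')"
    and t: "t < r" "t' < r"
  shows "(\<Sum>i\<in>I. B t i * A i t') = of_bool (t = t')"
proof -
  obtain f where f: "bij_betw f {..<r} I"
    using ex_bij_betw_nat_finite[OF fin] card by (auto simp: lessThan_atLeast0)
  define MA where "MA = mat r r (\<lambda>(k, t). A (f k) t)"
  define MB where "MB = mat r r (\<lambda>(t, k). B t (f k))"
  have carr: "MA \<in> carrier_mat r r" "MB \<in> carrier_mat r r"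
    by (simp_all add: MA_def MB_def)
  have fI: "f k \<in> I" if "k < r" for k
    using f that by (auto simp: bij_betw_def)
  have finj: "f k = f l \<longleftrightarrow> k = l" if "k < r" "l < r" for k l
    using f that by (auto simp: bij_betw_def inj_on_def)
  have "MA * MB = 1\<^sub>m r"
  proof (rule eq_matI)
    fix k l assume kl: "k < dim_row (1\<^sub>m r :: 'c mat)" "l < dim_col (1\<^sub>m r :: 'c mat)"
    then have "(MA * MB) $$ (k, l) = (\<Sum>t<r. A (f k) t * B t (f l))"
      by (simp add: MA_def MB_def scalar_prod_def lessThan_atLeast0)
    also have "\<dots> = of_bool (k = l)"
      using kl by (simp add: inv fI finj)
    finally show "(MA * MB) $$ (k, l) = 1\<^sub>m r $$ (k, l)"
      using kl by simp
  qed (simp_all add: MA_def MB_def)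
  then have "MB * MA = 1\<^sub>m r"
    by (rule mat_mult_left_right_inverse[OF carr])
  then have "(MB * MA) $$ (t, t') = of_bool (t = t')"
    using t by simp
  moreover have "(MB * MA) $$ (t, t') = (\<Sum>k<r. B t (f k) * A (f k) t')"
    using t by (simp add: MA_def MB_def scalar_prod_def lessThan_atLeast0)
  moreover have "\<dots> = (\<Sum>i\<in>I. B t i * A i t')"
    using sum.reindex_bij_betw[OF f, of "\<lambda>i. B t i * A i t'"] by simp
  ultimately show ?thesis by simp
qed

text \<open>The last term is 1 and neighbours cancel, so only the parity of the number of terms
  matters.\<close>

lemma sum_alternating_from_even:
  "even a \<Longrightarrow> a \<le> b \<Longrightarrow> (\<Sum>j=a..b. (-1) ^ (b + j)) = (of_bool (even b) :: 'a::comm_ring_1)"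
proof (induction b rule: nat_induct)
  case 0 then show ?case by simp
next
  case (Suc b)
  show ?case
  proof (cases "a = Suc b")
    case False
    then have "a \<le> b" using Suc by simp
    then have "(\<Sum>j=a..b. (-1) ^ (Suc b + j) :: 'a) = - of_bool (even b)"
      using Suc by (simp add: sum_negf)
    then show ?thesis using \<open>a \<le> b\<close> by (simp add: atLeastAtMostSuc_conv)
  qed (use Suc.prems in simp)
qed

lemma sum_alternating_even: "even n \<Longrightarrow> (\<Sum>j<n. (-1) ^ j) = (0 :: 'a::comm_ring_1)"
proof (induction n rule: nat_less_induct)
  case (1 n)
  then show ?case
    by (cases n; cases "n - 1") auto
qed

lemma card_even_less: "even n \<Longrightarrow> card {i. i < n \<and> even i} = n div 2"
proof -
  assume "even n"
  then obtain k where "n = 2 * k" ..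
  then have "{i. i < n \<and> even i} = (\<lambda>i. 2 * i) ` {..<k}"
    by (auto elim!: evenE)
  then show ?thesis
    using \<open>n = 2 * k\<close> by (simp add: card_image inj_on_def)
qed

section \<open>Zero pattern and kernel vectors of the matrix\<close>

text \<open>\<open>\<sigma>\<close> is the cyclic successor within a block and \<open>s i\<close> the first index of the block of \<open>i\<close>.
  Since all block sizes are even, the parity of an index does not depend on whether it is counted
  globally or within its block.\<close>

locale block_cycles =
  fixes n :: nat and \<sigma> s :: "nat \<Rightarrow> nat"
  assumes even_n: "even n"
    and succ_less: "i < n \<Longrightarrow> \<sigma> i < n"
    and inj_succ: "inj_on \<sigma> {..<n}"
    and even_succ: "i < n \<Longrightarrow> even (\<sigma> i) \<longleftrightarrow> odd i"
    and start_succ: "i < n \<Longrightarrow> s (\<sigma> i) = s i"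
    and even_start: "i < n \<Longrightarrow> even (s i)"
    and start_le: "i < n \<Longrightarrow> s i \<le> i"
    and start_between: "i < n \<Longrightarrow> s i \<le> j \<Longrightarrow> j \<le> i \<Longrightarrow> s j = s i"
    and succ_cases: "i < n \<Longrightarrow> \<sigma> i = Suc i \<or> \<sigma> i = s i"
begin

text \<open>For \<open>n \<ge> 4\<close> the rows of \<open>entry\<close> with these indices are
  linearly independent: \<open>entry_inv\<close> is a right inverse for them.\<close>

definition nonlast :: "nat set" where
  "nonlast = {i. i < n \<and> \<sigma> i = Suc i}"

definition starts :: "nat set" where
  "starts = {i. i < n \<and> s i = i}"

definition entry :: "nat \<Rightarrow> nat \<Rightarrow> bool" where
  "entry i j \<longleftrightarrow> j \<noteq> i \<and> j \<noteq> \<sigma> i"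

lemma succ_neq: "i < n \<Longrightarrow> \<sigma> i \<noteq> i"
  using even_succ by metis

lemma bij_succ: "bij_betw \<sigma> {..<n} {..<n}"
  unfolding bij_betw_def using inj_succ succ_less by (intro conjI endo_inj_surj) auto

lemma succ_surj:
  assumes "j < n"
  obtains i where "i < n" "j = \<sigma> i"
  using bij_betw_imp_surj_on[OF bij_succ] assms by (metis imageE lessThan_iff)

text \<open>Wrapping around leads to the even index \<open>s i\<close>, but the successor of an even
  index is odd.\<close>

lemma even_nonlast: "i < n \<Longrightarrow> even i \<Longrightarrow> i \<in> nonlast"
  using succ_cases[of i] even_succ[of i] even_start[of i] by (auto simp: nonlast_def)

lemma nonlast_less: "i \<in> nonlast \<Longrightarrow> i < n"
  by (simp add: nonlast_def)

text \<open>The injective map \<open>\<sigma>\<close> takes the indices outside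
  \<open>nonlast\<close> onto \<open>starts\<close>.\<close>

lemma card_nonlast: "card nonlast = n - card starts"
proof -
  have iff: "\<sigma> i \<in> starts \<longleftrightarrow> i \<notin> nonlast" if "i < n" for i
  proof (cases "\<sigma> i = Suc i")
    case True
    then show ?thesis
      using that start_succ[OF that] start_le[OF that] by (simp add: starts_def nonlast_def)
  next
    case False
    then have "s (\<sigma> i) = \<sigma> i"
      using succ_cases[OF that] start_succ[OF that] by metis
    then show ?thesis
      using False that by (simp add: starts_def nonlast_def succ_less)
  qed
  have *: "\<sigma> ` ({..<n} - nonlast) = starts"
  proof (intro equalityI subsetI)
    fix j assume "j \<in> starts"
    moreover from this obtain i where "i < n" "j = \<sigma> i"
      using succ_surj[of j] by (auto simp: starts_def)
    ultimately show "j \<in> \<sigma> ` ({..<n} - nonlast)"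
      using iff by auto
  qed (use iff in auto)
  have "inj_on \<sigma> ({..<n} - nonlast)"
    using inj_succ by (rule inj_on_subset) auto
  then have "card starts = card ({..<n} - nonlast)"
    using card_image * by metis
  also have "\<dots> = n - card nonlast"
    by (subst card_Diff_subset) (auto simp: nonlast_def)
  finally show ?thesis
    using card_mono[of "{..<n}" nonlast] nonlast_less by (simp add: subset_iff)
qed

lemma sum_entry_row:
  fixes f :: "nat \<Rightarrow> 'a::comm_ring_1"
  assumes "i < n"
  shows "(\<Sum>j<n. of_bool (entry i j) * f j) = (\<Sum>j<n. f j) - f i - f (\<sigma> i)"
proof -
  have "(\<Sum>j<n. f j) = (\<Sum>j<n. of_bool (entry i j) * f j) + (\<Sum>j\<in>{i, \<sigma> i}. f j)"
  proof -
    have "(\<Sum>j<n. f j) = (\<Sum>j\<in>{..<n} - {i, \<sigma> i}. f j) + (\<Sum>j\<in>{i, \<sigma> i}. f j)"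
      using assms succ_less by (intro sum.subset_diff) auto
    moreover have "(\<Sum>j\<in>{..<n} - {i, \<sigma> i}. f j) = (\<Sum>j<n. of_bool (entry i j) * f j)"
      by (intro sum.mono_neutral_cong_left) (auto simp: entry_def)
    ultimately show ?thesis by simp
  qed
  then show ?thesis
    using succ_neq[OF assms] by simp
qed

text \<open>By injectivity of \<open>\<sigma>\<close>, column \<open>\<sigma> i\<close> has its
  zeros exactly in rows \<open>i\<close> and \<open>\<sigma> i\<close>.\<close>

lemma sum_entry_column:
  fixes f :: "nat \<Rightarrow> 'a::comm_ring_1"
  assumes "i < n"
  shows "(\<Sum>k<n. f k * of_bool (entry k (\<sigma> i))) = (\<Sum>k<n. f k) - f i - f (\<sigma> i)"
proof -
  have entry: "entry k (\<sigma> i) \<longleftrightarrow> k \<noteq> i \<and> k \<noteq> \<sigma> i" if "k < n" for k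
    using inj_succ assms that by (auto simp: entry_def inj_on_def)
  have "(\<Sum>k<n. f k * of_bool (entry k (\<sigma> i))) = (\<Sum>k<n. of_bool (entry i k) * f k)"
    by (intro sum.cong) (auto simp: entry entry_def[of i])
  then show ?thesis
    using sum_entry_row[OF assms] by simp
qed

text \<open>The two omitted columns have opposite parity, so their signs cancel.\<close>

lemma alternating_row: "i < n \<Longrightarrow> (\<Sum>j<n. of_bool (entry i j) * (-1) ^ j) = (0 :: 'a::comm_ring_1)"
  using even_succ[of i]
  by (cases "even i") (simp_all add: sum_entry_row sum_alternating_even[OF even_n])

lemma alternating_column: "j < n \<Longrightarrow> (\<Sum>k<n. (-1) ^ k * of_bool (entry k j)) = (0 :: 'a::comm_ring_1)"
proof -
  assume "j < n"
  then obtain i where "i < n" "j = \<sigma> i"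
    by (rule succ_surj)
  then show ?thesis
    using even_succ[of i]
    by (cases "even i") (simp_all add: sum_entry_column sum_alternating_even[OF even_n])
qed

text \<open>An even row \<open>i\<close> omits just one even column, \<open>i\<close> itself,
  because \<open>\<sigma> i\<close> is odd.\<close>

lemma sum_even_entries:
  "(\<Sum>i<n. \<Sum>j<n. of_bool (even i) * of_bool (even j) * of_bool (entry i j))
     = (rat_of_nat (n div 2) * (rat_of_nat (n div 2) - 1))"
proof -
  have K: "(\<Sum>j<n. of_bool (even j) :: rat) = of_nat (n div 2)"
    using card_even_less[OF even_n] by (simp add: sum_of_bool_eq Collect_conj_eq lessThan_def)
  have "(\<Sum>j<n. of_bool (even i) * of_bool (even j) * of_bool (entry i j))
      = (of_bool (even i) * (of_nat (n div 2) - 1) :: rat)" if "i < n" for i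
  proof -
    have "(\<Sum>j<n. of_bool (even i) * of_bool (even j) * of_bool (entry i j))
      = (of_bool (even i) * (\<Sum>j<n. of_bool (entry i j) * of_bool (even j)) :: rat)"
      by (simp add: sum_distrib_left mult_ac)
    also have "\<dots> = of_bool (even i) * (of_nat (n div 2) - 1)"
      using that even_succ[of i] by (subst sum_entry_row) (auto simp: K)
    finally show ?thesis .
  qed
  then show ?thesis
    by (simp add: K flip: sum_distrib_right)
qed

section \<open>Lower bound: generalized inverse and divisibility\<close>

text \<open>On \<open>nonlast\<close> the complement of \<open>entry\<close> is block diagonal with bidiagonal blocks \<open>T\<close>, whose
  inverses have entries \<open>\<plusminus>1\<close>. By the Sherman--Morrison formula the inverse of
  \<open>J - T\<close> then has a single denominator, \<open>n / 2 - 1\<close>.\<close>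

definition block_inv :: "nat \<Rightarrow> nat \<Rightarrow> int" where
  "block_inv j i = (if j \<le> i \<and> s j = s i then (-1) ^ (i + j) else 0)"

definition entry_inv :: "nat \<Rightarrow> nat \<Rightarrow> rat" where
  "entry_inv j i =
     of_bool (even j) * of_bool (even i) / (of_nat (n div 2) - 1) - of_int (block_inv j i)"

text \<open>The nonzero entries of the column form the interval from the even index
  \<open>s i\<close> to \<open>i\<close>. These column sums of the inverse of \<open>T\<close> enter
  the rank-one correction.\<close>

lemma sum_block_inv:
  assumes "i < n"
  shows "(\<Sum>j<n. block_inv j i) = of_bool (even i)"
proof -
  have iff: "j \<le> i \<and> s j = s i \<longleftrightarrow> s i \<le> j \<and> j \<le> i" for j
    using start_between[OF assms, of j] start_le[of j] assms by (metis le_less_trans)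
  have "(\<Sum>j<n. block_inv j i) = (\<Sum>j=s i..i. (-1) ^ (i + j))"
    unfolding block_inv_def iff using assms by (intro sum.mono_neutral_cong_right) auto
  then show ?thesis
    using assms by (simp add: sum_alternating_from_even even_start start_le)
qed

text \<open>This is \<open>T\<close> times its inverse: row \<open>i\<close> of \<open>T\<close> has
  its ones at \<open>i\<close> and \<open>Suc i\<close>.\<close>

lemma block_inv_Suc:
  assumes "i \<in> nonlast"
  shows "block_inv i k + block_inv (Suc i) k = of_bool (i = k)"
  using assms start_succ[of i]
  by (cases i k rule: linorder_cases) (auto simp: block_inv_def nonlast_def)

text \<open>Row \<open>i\<close> is the all-ones row minus the positions \<open>i\<close> and
  \<open>Suc i\<close>. Exactly one of these is even, so the fraction cancels against the column sum
  and \<open>block_inv_Suc\<close> remains.\<close>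

lemma entry_inv:
  assumes n: "n \<ge> 4" and i: "i \<in> nonlast" and k: "k \<in> nonlast"
  shows "(\<Sum>j<n. of_bool (entry i j) * entry_inv j k) = of_bool (i = k)"
proof -
  let ?K = "of_nat (n div 2) :: rat"
  have "n div 2 \<ge> 2" using n by linarith
  then have K1: "?K - 1 \<noteq> 0"
    by (metis of_nat_eq_1_iff eq_iff_diff_eq_0 numeral_le_one_iff semiring_norm(69))
  have K: "(\<Sum>j<n. of_bool (even j) :: rat) = ?K"
    using card_even_less[OF even_n] by (simp add: sum_of_bool_eq Collect_conj_eq lessThan_def)
  have "(\<Sum>j<n. entry_inv j k)
      = (\<Sum>j<n. of_bool (even j)) * of_bool (even k) / (?K - 1) - of_int (\<Sum>j<n. block_inv j k)"
    by (simp add: entry_inv_def sum_subtractf sum_distrib_right sum_divide_distrib)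
  also have "\<dots> = of_bool (even k) / (?K - 1)"
    using K1 k by (simp only: K) (simp add: sum_block_inv nonlast_less field_simps)
  finally have sum: "(\<Sum>j<n. entry_inv j k) = of_bool (even k) / (?K - 1)" .
  have "entry_inv i k + entry_inv (Suc i) k
      = of_bool (even k) / (?K - 1) - of_int (block_inv i k + block_inv (Suc i) k)"
    by (simp add: entry_inv_def)
  then have "entry_inv i k + entry_inv (Suc i) k = of_bool (even k) / (?K - 1) - of_bool (i = k)"
    by (simp only: block_inv_Suc[OF i]) simp
  then show ?thesis
    using i by (subst sum_entry_row) (auto simp: sum nonlast_def algebra_simps)
qed

lemma card_le_half_of_factorization:
  fixes R C :: "nat \<Rightarrow> nat set"
  assumes n: "n \<ge> 4" and r: "r = card nonlast"
    and fact: "\<And>i j. i < n \<Longrightarrow> j < n \<Longrightarrow>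
      (\<Sum>t<r. of_bool (i \<in> R t) * of_bool (j \<in> C t)) = (of_bool (entry i j) :: rat)"
  shows "r \<le> n div 2"
proof -
  define X :: "nat \<Rightarrow> nat \<Rightarrow> rat" where "X i t = of_bool (i \<in> R t)" for i t
  define Y :: "nat \<Rightarrow> nat \<Rightarrow> rat" where "Y t j = of_bool (j \<in> C t)" for t j
  define W where "W t i = (\<Sum>j<n. Y t j * entry_inv j i)" for t i
  define K where "K = int (n div 2)"
  have XY: "(\<Sum>t<r. X i t * Y t j) = of_bool (entry i j)" if "i < n" "j < n" for i j
    using fact that by (simp add: X_def Y_def)
  have fin: "finite nonlast"
    by (simp add: nonlast_def)
  \<comment> \<open>\<open>W = Y G\<close> with \<open>G = entry_inv\<close>, so
    \<open>X W = M G\<close>, which is the identity on \<open>nonlast\<close>. As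
    \<open>r = card nonlast\<close>, it follows that \<open>W X = I\<close>.\<close>
  have XW: "(\<Sum>t<r. X i t * W t i') = (\<Sum>j<n. of_bool (entry i j) * entry_inv j i')" if "i < n" for i i'
  proof -
    have "(\<Sum>t<r. X i t * W t i') = (\<Sum>j<n. (\<Sum>t<r. X i t * Y t j) * entry_inv j i')"
      by (simp add: W_def sum_distrib_left sum_distrib_right mult.assoc sum.swap[of _ "{..<r}"])
    then show ?thesis using XY that by simp
  qed
  have WX: "(\<Sum>i\<in>nonlast. W t i * X i t') = of_bool (t = t')" if "t < r" "t' < r" for t t'
    using fin r[symmetric] that
    by (intro sum_left_right_inverse[where A = X and r = r]) (auto simp: XW nonlast_less entry_inv n)
  \<comment> \<open>With \<open>x\<close> the alternating row vector times \<open>X\<close>,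
    \<open>x W\<close> vanishes by the left kernel of \<open>M\<close>; multiplying by
    \<open>X\<close> recovers \<open>x\<close>.\<close>
  have alt_X: "(\<Sum>i<n. (-1) ^ i * X i t) = 0" if t: "t < r" for t
  proof -
    define x where "x t = (\<Sum>i<n. (-1) ^ i * X i t)" for t
    have "(\<Sum>t<r. x t * W t k) = 0" for k
    proof -
      have "(\<Sum>t<r. x t * W t k) = (\<Sum>i<n. (-1) ^ i * (\<Sum>t<r. X i t * W t k))"
        by (simp add: x_def sum_distrib_left sum_distrib_right mult.assoc sum.swap[of _ "{..<r}"])
      also have "\<dots> = (\<Sum>i<n. (-1) ^ i * (\<Sum>j<n. of_bool (entry i j) * entry_inv j k))"
        by (simp add: XW)
      also have "\<dots> = (\<Sum>j<n. (\<Sum>i<n. (-1) ^ i * of_bool (entry i j)) * entry_inv j k)"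
        unfolding sum_distrib_left sum_distrib_right mult.assoc by (rule sum.swap)
      also have "\<dots> = 0"
        by (intro sum.neutral ballI) (simp only: alternating_column lessThan_iff mult_zero_left)
      finally show ?thesis .
    qed
    then have "0 = (\<Sum>k\<in>nonlast. (\<Sum>t'<r. x t' * W t' k) * X k t)"
      by simp
    also have "\<dots> = (\<Sum>t'<r. x t' * (\<Sum>k\<in>nonlast. W t' k * X k t))"
      unfolding sum_distrib_left sum_distrib_right mult.assoc by (rule sum.swap)
    also have "\<dots> = (\<Sum>t'<r. if t' = t then x t' else 0)"
      by (intro sum.cong) (auto simp: WX t)
    also have "\<dots> = x t" using t by simp
    finally show ?thesis by (simp add: x_def)
  qed
  \<comment> \<open>Dually, \<open>X y = 0\<close> by the right kernel, and \<open>W\<close> on the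
    left recovers \<open>y\<close>.\<close>
  have alt_Y: "(\<Sum>j<n. Y t j * (-1) ^ j) = 0" if t: "t < r" for t
  proof -
    define y where "y t = (\<Sum>j<n. Y t j * (-1) ^ j)" for t
    have "(\<Sum>t'<r. X i t' * y t') = 0" if "i < n" for i
    proof -
      have "(\<Sum>t'<r. X i t' * y t') = (\<Sum>j<n. (\<Sum>t'<r. X i t' * Y t' j) * (-1) ^ j)"
        unfolding y_def sum_distrib_left sum_distrib_right mult.assoc by (rule sum.swap)
      also have "\<dots> = (\<Sum>j<n. of_bool (entry i j) * (-1) ^ j)"
        using that by (intro sum.cong refl) (simp only: XY lessThan_iff)
      finally show ?thesis by (simp only: alternating_row[OF that])
    qed
    then have "0 = (\<Sum>i\<in>nonlast. W t i * (\<Sum>t'<r. X i t' * y t'))"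
      by (simp add: nonlast_less)
    also have "\<dots> = (\<Sum>t'<r. (\<Sum>i\<in>nonlast. W t i * X i t') * y t')"
      unfolding sum_distrib_left sum_distrib_right mult.assoc by (rule sum.swap)
    also have "\<dots> = (\<Sum>t'<r. if t = t' then y t' else 0)"
      by (intro sum.cong) (auto simp: WX t)
    also have "\<dots> = y t" using t by simp
    finally show ?thesis by (simp add: y_def)
  qed
  define a where "a t = int (card {i. i < n \<and> even i \<and> i \<in> R t})" for t
  define b where "b t = int (card {j. j < n \<and> even j \<and> j \<in> C t})" for t
  have a: "(\<Sum>i<n. of_bool (even i) * X i t) = of_int (a t)" for t
    by (simp add: a_def X_def sum_of_bool_eq lessThan_def Collect_conj_eq Int_ac flip: of_bool_conj)
  have b: "(\<Sum>j<n. Y t j * of_bool (even j)) = of_int (b t)" for t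
    by (simp add: b_def Y_def sum_of_bool_eq lessThan_def Collect_conj_eq Int_ac flip: of_bool_conj)
  \<comment> \<open>Restricting to \<open>nonlast\<close> loses no even index.\<close>
  have a': "(\<Sum>i\<in>nonlast. of_bool (even i) * X i t) = of_int (a t)" for t
    unfolding a[symmetric] by (intro sum.mono_neutral_left) (auto simp: nonlast_less even_nonlast)
  have K: "K \<ge> 2" using n by (simp add: K_def)
  have ab_ge: "a t * b t \<ge> K - 1" if t: "t < r" for t
  proof -
    \<comment> \<open>With odd elements only, every term would be -1.\<close>
    have ex_even: "\<exists>i\<in>U. even i"
      if "finite U" "U \<noteq> {}" "(\<Sum>i\<in>U. (-1) ^ i) = (0::rat)" for U :: "nat set"
    proof (rule ccontr)
      assume "\<not> ?thesis"
      then have "(\<Sum>i\<in>U. (-1) ^ i) = (\<Sum>i\<in>U. - 1 :: rat)"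
        by (intro sum.cong) auto
      then show False
        using that by simp
    qed
    define U where "U = {i. i < n \<and> i \<in> R t}"
    define V where "V = {j. j < n \<and> j \<in> C t}"
    \<comment> \<open>The integral part of \<open>G\<close> contributes \<open>- d\<close> to the
      diagonal entry of \<open>W X\<close>, the fraction contributes
      \<open>a t * b t / (K - 1)\<close>, and the two add up to 1.\<close>
    define d where "d = (\<Sum>i\<in>nonlast. \<Sum>j<n. of_bool (j \<in> C t) * block_inv j i * of_bool (i \<in> R t))"
    have one: "(\<Sum>i\<in>nonlast. W t i * X i t) = 1"
      using WX[OF t t] by simp
    have "U \<noteq> {}"
    proof
      assume "U = {}"
      then have "X i t = 0" if "i \<in> nonlast" for i
        using that nonlast_less by (auto simp: U_def X_def)
      then show False using one by simp
    qed
    have "V \<noteq> {}"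
    proof
      assume "V = {}"
      then have "W t i = 0" for i
        by (auto simp: V_def W_def Y_def intro!: sum.neutral)
      then show False using one by simp
    qed
    have "(\<Sum>i\<in>U. (-1) ^ i) = (0::rat)"
      unfolding alt_X[OF t, symmetric]
      by (intro sum.mono_neutral_cong_left) (auto simp: U_def X_def)
    then have "\<exists>i\<in>U. even i"
      using ex_even[OF _ \<open>U \<noteq> {}\<close>] by (simp add: U_def)
    then have "a t > 0"
      by (auto simp: a_def U_def card_gt_0_iff)
    have "(\<Sum>j\<in>V. (-1) ^ j) = (0::rat)"
      unfolding alt_Y[OF t, symmetric]
      by (intro sum.mono_neutral_cong_left) (auto simp: V_def Y_def)
    then have "\<exists>j\<in>V. even j"
      using ex_even[OF _ \<open>V \<noteq> {}\<close>] by (simp add: V_def)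
    then have "b t > 0"
      by (auto simp: b_def V_def card_gt_0_iff)
    have W: "W t i = of_int (b t) * of_bool (even i) / of_int (K - 1)
        - (\<Sum>j<n. Y t j * of_int (block_inv j i))" for i
      unfolding W_def entry_inv_def b[symmetric]
      by (simp add: K_def right_diff_distrib sum_subtractf sum_distrib_right sum_divide_distrib mult_ac)
    have "1 = (\<Sum>i\<in>nonlast. of_int (b t) / of_int (K - 1) * (of_bool (even i) * X i t))
        - (\<Sum>i\<in>nonlast. \<Sum>j<n. Y t j * of_int (block_inv j i) * X i t)"
      unfolding one[symmetric] W left_diff_distrib sum_subtractf sum_distrib_right
      by (simp add: mult.assoc)
    also have "\<dots> = of_int (b t) / of_int (K - 1) * of_int (a t) - of_int d"
      unfolding sum_distrib_left[symmetric] a' by (simp add: d_def X_def Y_def)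
    finally have "of_int (a t * b t) = (of_int ((K - 1) * (d + 1)) :: rat)"
      using K by (simp add: field_simps)
    then have "a t * b t = (K - 1) * (d + 1)"
      by (simp only: of_int_eq_iff)
    then have "K - 1 dvd a t * b t" by simp
    then show ?thesis
      using \<open>a t > 0\<close> \<open>b t > 0\<close> zdvd_imp_le by simp
  qed
  \<comment> \<open>Counts the ones with both indices even, rectangle by rectangle.\<close>
  have "(of_int (\<Sum>t<r. a t * b t) :: rat)
      = (\<Sum>t<r. (\<Sum>i<n. of_bool (even i) * X i t) * (\<Sum>j<n. Y t j * of_bool (even j)))"
    by (simp only: a b of_int_sum of_int_mult)
  also have "\<dots> = (\<Sum>t<r. \<Sum>i<n. \<Sum>j<n. of_bool (even i) * of_bool (even j) * (X i t * Y t j))"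
    unfolding sum_product by (intro sum.cong refl) (simp only: mult_ac)
  also have "\<dots> = (\<Sum>i<n. \<Sum>j<n. of_bool (even i) * of_bool (even j) * (\<Sum>t<r. X i t * Y t j))"
    unfolding sum_distrib_left by (subst sum.swap, rule sum.cong[OF refl], rule sum.swap)
  also have "\<dots> = (\<Sum>i<n. \<Sum>j<n. of_bool (even i) * of_bool (even j) * of_bool (entry i j))"
    by (intro sum.cong refl) (simp only: XY lessThan_iff)
  also have "\<dots> = of_int (K * (K - 1))"
    unfolding sum_even_entries by (simp add: K_def)
  finally have "(\<Sum>t<r. a t * b t) = K * (K - 1)"
    by (simp only: of_int_eq_iff)
  moreover have "(\<Sum>t<r. K - 1) \<le> (\<Sum>t<r. a t * b t)"
    by (intro sum_mono) (simp add: ab_ge)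
  ultimately have "int r * (K - 1) \<le> K * (K - 1)"
    by simp
  then have "int r \<le> K"
    using K by (simp add: mult_le_cancel_right)
  then show ?thesis by (simp add: K_def)
qed

lemma card_gt_of_partition:
  assumes n: "n \<ge> 4" and starts: "card starts < n div 2"
    and P: "finite P" "partition_on {(i, j). i < n \<and> j < n \<and> entry i j} P"
    and rect: "\<And>S. S \<in> P \<Longrightarrow> \<exists>R C. S = R \<times> C"
  shows "card P > n - card starts"
proof (rule ccontr)
  let ?r = "n - card starts"
  assume "\<not> ?thesis"
  then have le: "card P \<le> ?r" by simp
  obtain e where e: "bij_betw e {..<card P} P"
    using ex_bij_betw_nat_finite[OF P(1)] by (auto simp: lessThan_atLeast0)
  \<comment> \<open>Padding with empty rectangles gives the factorization inner dimension exactly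
    \<open>card nonlast\<close>.\<close>
  define R where "R t = (if t < card P then fst ` e t else {})" for t
  define C where "C t = (if t < card P then snd ` e t else {})" for t
  have mem: "i \<in> R t \<and> j \<in> C t \<longleftrightarrow> t < card P \<and> (i, j) \<in> e t" for i j t
  proof (cases "t < card P")
    case True
    then obtain U V where "e t = U \<times> V"
      using rect e by (metis bij_betwE lessThan_iff)
    then show ?thesis
      using True by (force simp: R_def C_def)
  qed (simp add: R_def)
  have "(\<Sum>t<?r. of_bool (i \<in> R t) * of_bool (j \<in> C t)) = (of_bool (entry i j) :: rat)"
    if ij: "i < n" "j < n" for i j
  proof -
    have "(\<Sum>t<?r. of_bool (i \<in> R t) * of_bool (j \<in> C t))
        = (\<Sum>t<card P. of_bool ((i, j) \<in> e t) :: rat)"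
      using le by (intro sum.mono_neutral_cong_right) (auto simp: mem simp flip: of_bool_conj)
    also have "\<dots> = (\<Sum>S\<in>P. of_bool ((i, j) \<in> S))"
      by (rule sum.reindex_bij_betw[OF e, of "\<lambda>S. of_bool ((i, j) \<in> S)"])
    also have "\<dots> = of_bool (entry i j)"
    proof (cases "entry i j")
      case True
      then have "(i, j) \<in> \<Union>P"
        using partition_onD1[OF P(2)] ij by auto
      then obtain T where T: "T \<in> P" "(i, j) \<in> T"
        by blast
      have "(i, j) \<in> S \<longleftrightarrow> S = T" if "S \<in> P" for S
        using disjointD[OF partition_onD2[OF P(2)] that T(1)] T(2) by blast
      then have "(\<Sum>S\<in>P. of_bool ((i, j) \<in> S)) = (\<Sum>S\<in>P. if S = T then 1 else 0 :: rat)"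
        by (intro sum.cong) auto
      then show ?thesis
        using True T P(1) by simp
    next
      case False
      then have "(i, j) \<notin> \<Union>P"
        using partition_onD1[OF P(2)] by auto
      then show ?thesis
        using False by (auto intro!: sum.neutral)
    qed
    finally show ?thesis .
  qed
  then have "?r \<le> n div 2"
    by (rule card_le_half_of_factorization[OF n card_nonlast[symmetric]])
  then show False
    using starts even_n by (elim evenE) simp
qed

section \<open>Upper bound: an explicit partition\<close>

text \<open>Row \<open>i\<close> of the matrix is the disjoint union of \<open>colset i\<close> and \<open>colset (\<sigma> i)\<close>. All the
  sets \<open>colset t\<close> for \<open>t \<in> starts\<close> coincide, and identifying these indices through \<open>key\<close> leaves
  \<open>n - card starts + 1\<close> rectangles.\<close>

definition colset :: "nat \<Rightarrow> nat set" where
  "colset t = {j. j < n \<and> (if s j = s t then (even j \<longleftrightarrow> even t) \<and> j \<noteq> t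
     else even t \<longleftrightarrow> even j \<and> s j \<noteq> j)}"

definition key :: "nat \<Rightarrow> nat" where
  "key i = (if i \<in> starts then 0 else i)"

text \<open>A non-start key serves two cyclically adjacent rows; key 0 serves the first and last
  rows of all blocks.\<close>

definition rowset :: "nat \<Rightarrow> nat set" where
  "rowset k = {i. i < n \<and> (key i = k \<or> key (\<sigma> i) = k)}"

text \<open>Inside its block, \<open>j \<noteq> t\<close> removes the only start; outside, an even
  \<open>t\<close> avoids starts by definition. So the set does not depend on
  \<open>t\<close>.\<close>

lemma colset_start:
  assumes "t \<in> starts"
  shows "colset t = {j. j < n \<and> even j \<and> s j \<noteq> j}"
proof -
  have t: "t < n" "s t = t" using assms by (auto simp: starts_def)
  then have "even t" using even_start by metis
  then show ?thesis using t by (auto simp: colset_def)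
qed

text \<open>Index 0 is itself a start and can represent them all.\<close>

lemma colset_key: "i < n \<Longrightarrow> colset (key i) = colset i"
proof -
  assume "i < n"
  then have "0 \<in> starts"
    using start_le[of 0] by (auto simp: starts_def)
  then show ?thesis
    by (simp add: key_def colset_start)
qed

text \<open>\<open>i\<close> and \<open>\<sigma> i\<close> have opposite parity: inside the block
  they share the columns by parity, each omitting itself, and outside their conditions are
  complementary.\<close>

lemma colset_cover:
  assumes "i < n" "j < n"
  shows "j \<in> colset i \<or> j \<in> colset (\<sigma> i) \<longleftrightarrow> entry i j"
proof (cases "s j = s i")
  case True
  then show ?thesis
    using assms even_succ[OF assms(1)] start_succ[OF assms(1)]
    by (cases "even i"; cases "even j") (auto simp: colset_def entry_def)
next
  case False
  then have "j \<noteq> i" "j \<noteq> \<sigma> i"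
    using start_succ[OF assms(1)] by auto
  then show ?thesis
    using False assms even_succ[OF assms(1)] start_succ[OF assms(1)]
    by (auto simp: colset_def entry_def)
qed

lemma colset_disjoint: "i < n \<Longrightarrow> colset i \<inter> colset (\<sigma> i) = {}"
  using even_succ[of i] start_succ[of i] by (auto simp: colset_def split: if_splits)

lemma ex_rectangle_partition:
  assumes "n > 0"
  shows "\<exists>P. finite P \<and> card P \<le> n - card starts + 1 \<and>
    partition_on {(i, j). i < n \<and> j < n \<and> entry i j} P \<and> (\<forall>S\<in>P. \<exists>R C. S = R \<times> C)"
proof -
  define keys where "keys = insert 0 ({..<n} - starts)"
  define rect where "rect k = rowset k \<times> colset k" for k
  \<comment> \<open>Some rectangles may be empty and parts may not, hence only an upper bound on the
    cardinality.\<close>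
  define P where "P = rect ` keys - {{}}"
  have "finite starts" "starts \<subseteq> {..<n}"
    by (auto simp: starts_def)
  then have "card keys \<le> n - card starts + 1"
    unfolding keys_def using card_insert_le_m1[of "n - card starts + 1" "{..<n} - starts" 0]
    by (simp add: card_Diff_subset)
  moreover have "finite keys"
    by (simp add: keys_def)
  then have "finite (rect ` keys)" "card (rect ` keys) \<le> card keys"
    by (simp_all add: card_image_le)
  moreover have "card P \<le> card (rect ` keys)"
    unfolding P_def using \<open>finite keys\<close> by (intro card_mono) auto
  ultimately have card: "finite P" "card P \<le> n - card starts + 1"
    by (auto simp: P_def)
  have "partition_on {(i, j). i < n \<and> j < n \<and> entry i j} P"
  proof (rule partition_onI)
    show "\<Union>P = {(i, j). i < n \<and> j < n \<and> entry i j}"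
    proof (intro equalityI subsetI)
      fix x assume "x \<in> \<Union>P"
      then obtain i j k where x: "x = (i, j)" "i \<in> rowset k" "j \<in> colset k"
        by (auto simp: P_def rect_def)
      then have less: "i < n" "j < n"
        by (auto simp: rowset_def colset_def)
      then have "j \<in> colset i \<or> j \<in> colset (\<sigma> i)"
        using x colset_key succ_less by (auto simp: rowset_def)
      then show "x \<in> {(i, j). i < n \<and> j < n \<and> entry i j}"
        using x less colset_cover by auto
    next
      fix x assume "x \<in> {(i, j). i < n \<and> j < n \<and> entry i j}"
      then obtain i j where x: "x = (i, j)" "i < n" "j < n" "entry i j"
        by auto
      then obtain l where l: "l < n" "j \<in> colset l" "l = i \<or> l = \<sigma> i"
        using colset_cover succ_less by blast
      then have "x \<in> rect (key l)"
        using x by (auto simp: rect_def rowset_def colset_key)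
      moreover have "key l \<in> keys"
        using l by (auto simp: keys_def key_def)
      ultimately show "x \<in> \<Union>P"
        by (auto simp: P_def)
    qed
  next
    fix S T assume ST: "S \<in> P" "T \<in> P" "S \<noteq> T"
    then obtain k l where kl: "S = rect k" "T = rect l" "k \<noteq> l"
      by (auto simp: P_def)
    have "False" if "(i, j) \<in> rect k" "(i, j) \<in> rect l" for i j
    proof -
      \<comment> \<open>Two distinct keys sharing row \<open>i\<close> must be those of
        \<open>i\<close> and \<open>\<sigma> i\<close>, whose column sets are disjoint.\<close>
      have i: "i < n" "{k, l} = {key i, key (\<sigma> i)}" and j: "j \<in> colset k" "j \<in> colset l"
        using that kl(3) by (auto simp: rect_def rowset_def)
      then have "j \<in> colset i" "j \<in> colset (\<sigma> i)"
        using colset_key succ_less by (auto simp: doubleton_eq_iff)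
      then show False
        using colset_disjoint[OF i(1)] by blast
    qed
    then show "disjnt S T"
      by (auto simp: kl disjnt_def)
  qed (simp add: P_def)
  moreover have "\<forall>S\<in>P. \<exists>R C. S = R \<times> C"
    by (auto simp: P_def rect_def)
  ultimately show ?thesis
    using card by blast
qed

end

section \<open>Lists of block sizes and the concrete circulant matrix\<close>

fun block_start :: "nat list \<Rightarrow> nat \<Rightarrow> nat" where
  "block_start [] i = i"
| "block_start (k # ns) i = (if i < k then 0 else k + block_start ns (i - k))"

fun block_succ :: "nat list \<Rightarrow> nat \<Rightarrow> nat" where
  "block_succ [] i = i"
| "block_succ (k # ns) i =
     (if i < k then if Suc i < k then Suc i else 0 else k + block_succ ns (i - k))"

text \<open>Prepending a block shifts the remaining indices by an even \<open>k\<close>, which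
  preserves parities.\<close>

lemma block_cycles_list:
  "\<forall>k\<in>set ns. k \<ge> 2 \<and> even k \<Longrightarrow> block_cycles (sum_list ns) (block_succ ns) (block_start ns)"
proof (induction ns)
  case Nil
  then show ?case by unfold_locales auto
next
  case (Cons k ns)
  then interpret IH: block_cycles "sum_list ns" "block_succ ns" "block_start ns"
    by simp
  have k: "k \<ge> 2" "even k" using Cons.prems by auto
  show ?case
  proof
    show "even (sum_list (k # ns))" using k IH.even_n by simp
    show "inj_on (block_succ (k # ns)) {..<sum_list (k # ns)}"
    proof (rule inj_onI)
      fix i j
      assume ij: "i \<in> {..<sum_list (k # ns)}" "j \<in> {..<sum_list (k # ns)}"
        and eq: "block_succ (k # ns) i = block_succ (k # ns) j"
      show "i = j"
      proof (cases "i < k \<or> j < k")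
        case True
        then show ?thesis using eq k by (auto split: if_splits)
      next
        case False
        then have "i - k = j - k"
          using eq ij by (auto intro: inj_onD[OF IH.inj_succ])
        then show ?thesis using False by auto
      qed
    qed
  next
    fix i assume i: "i < sum_list (k # ns)"
    let ?\<sigma> = "block_succ (k # ns)" and ?s = "block_start (k # ns)"
    have "?\<sigma> i < sum_list (k # ns) \<and> (even (?\<sigma> i) \<longleftrightarrow> odd i) \<and> ?s (?\<sigma> i) = ?s i \<and> even (?s i) \<and>
      ?s i \<le> i \<and> (?\<sigma> i = Suc i \<or> ?\<sigma> i = ?s i)"
    proof (cases "i < k")
      case True
      show ?thesis
      proof (cases "Suc i < k")
        case False
        then have "k = Suc i" using True by simp
        then show ?thesis using k by simp
      qed (use True in simp)
    next
      case False
      define j where "j = i - k"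
      have j: "i = k + j" "j < sum_list ns" using False i by (auto simp: j_def)
      show ?thesis
        using j k IH.succ_less[of j] IH.even_succ[of j] IH.start_succ[of j] IH.even_start[of j]
          IH.start_le[of j] IH.succ_cases[of j] by simp
    qed
    then show "?\<sigma> i < sum_list (k # ns)" "even (?\<sigma> i) \<longleftrightarrow> odd i" "?s (?\<sigma> i) = ?s i" "even (?s i)"
      "?s i \<le> i" "?\<sigma> i = Suc i \<or> ?\<sigma> i = ?s i"
      by blast+
  next
    fix i j
    assume i: "i < sum_list (k # ns)" and j: "block_start (k # ns) i \<le> j" "j \<le> i"
    show "block_start (k # ns) j = block_start (k # ns) i"
    proof (cases "i < k")
      case False
      then show ?thesis
        using i j IH.start_between[of "i - k" "j - k"] by auto
    qed (use j in simp)
  qed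
qed

text \<open>Each prepended block contributes the new fixed point 0 and shifts the old ones.\<close>

lemma card_block_start_fixed:
  "\<forall>k\<in>set ns. k > 0 \<Longrightarrow> card {i. i < sum_list ns \<and> block_start ns i = i} = length ns"
proof (induction ns)
  case (Cons k ns)
  let ?F = "\<lambda>ns. {i. i < sum_list ns \<and> block_start ns i = i}"
  have k: "k > 0" using Cons.prems by simp
  have "?F (k # ns) = insert 0 ((+) k ` ?F ns)"
  proof (intro equalityI subsetI)
    fix i assume i: "i \<in> ?F (k # ns)"
    show "i \<in> insert 0 ((+) k ` ?F ns)"
    proof (cases "i < k")
      case False
      then have "i = k + (i - k)" "i - k \<in> ?F ns" using i by auto
      then show ?thesis by blast
    qed (use i in simp)
  qed (use k in auto)
  then have "card (?F (k # ns)) = card (insert 0 ((+) k ` ?F ns))"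
    by (rule arg_cong)
  also have "\<dots> = Suc (card (?F ns))"
    using k by (subst card_insert_disjoint) (auto simp: card_image)
  finally show ?case
    using Cons by simp
qed simp

text \<open>The residue of \<open>j - i\<close> must be 0 or 1; for \<open>j < i\<close> this forces
  the wrap-around \<open>i = n - 1\<close>, \<open>j = 0\<close>.\<close>

lemma circulant_D_entry:
  assumes "n \<ge> 2" "i < n" "j < n"
  shows "circulant_D n (n - 2) $$ (i, j) = of_bool (j = i \<or> j = (if Suc i < n then Suc i else 0))"
proof -
  have "(int j - int i) mod int n < 2 \<longleftrightarrow> j = i \<or> j = (if Suc i < n then Suc i else 0)"
  proof (cases "i \<le> j")
    case True
    then have "(int j - int i) mod int n = int j - int i"
      using assms by (intro mod_pos_pos_trivial) auto
    then show ?thesis using True assms by auto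
  next
    case False
    then have "(int j - int i) mod int n = (int j - int i + int n) mod int n"
      by simp
    also have "\<dots> = int j - int i + int n"
      using False assms by (intro mod_pos_pos_trivial) auto
    finally show ?thesis using False assms by auto
  qed
  then show ?thesis
    using assms by (simp add: circulant_D_def)
qed

lemma dim_circulant_block_diag:
  "dim_row (circulant_block_diag ns) = sum_list ns" "dim_col (circulant_block_diag ns) = sum_list ns"
  by (simp_all add: circulant_block_diag_def dim_diag_block_mat circulant_D_def comp_def)

lemma circulant_block_diag_entry:
  "\<forall>k\<in>set ns. k \<ge> 2 \<Longrightarrow> i < sum_list ns \<Longrightarrow> j < sum_list ns \<Longrightarrow>
    circulant_block_diag ns $$ (i, j) = of_bool (j = i \<or> j = block_succ ns i)"
proof (induction ns arbitrary: i j)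
  case (Cons k ns)
  have dim: "dim_row (circulant_D k (k - 2)) = k" "dim_col (circulant_D k (k - 2)) = k"
    by (simp_all add: circulant_D_def)
  have "circulant_block_diag (k # ns) $$ (i, j) =
    (if i < k then if j < k then circulant_D k (k - 2) $$ (i, j) else 0
     else if j < k then 0 else circulant_block_diag ns $$ (i - k, j - k))"
    using Cons.prems dim_circulant_block_diag[of ns] dim
    by (auto simp: circulant_block_diag_def Let_def)
  also have "\<dots> = of_bool (j = i \<or> j = block_succ (k # ns) i)"
    using Cons by (auto simp: circulant_D_entry)
  finally show ?case .
qed simp

lemma comb_rectangle_Times:
  "R \<times> C \<noteq> {} \<Longrightarrow> R \<times> C \<subseteq> ones A \<Longrightarrow> comb_rectangle A (R \<times> C)"
  unfolding comb_rectangle_def ones_def by (intro exI[of _ R] exI[of _ C]) auto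

theorem theorem5p1:
  fixes m n :: nat and ns :: "nat list" and M :: "int mat"
  assumes "m \<ge> 1" and "length ns = m"
    and "\<forall>i<m. ns ! i \<ge> 2 \<and> even (ns ! i)"
    and "M = complement_mat (circulant_block_diag ns)"
    and "n = (\<Sum>i<m. ns ! i)"
    and "\<exists>i<m. ns ! i > 2"
  shows "int (binary_rank M) = int n - int m + 1"
proof -
  have ns: "\<forall>k\<in>set ns. k \<ge> 2 \<and> even k"
    using assms(2,3) by (auto simp: in_set_conv_nth)
  have n: "n = sum_list ns"
    using assms(2,5) by (simp add: sum_list_sum_nth lessThan_atLeast0)
  interpret block_cycles n "block_succ ns" "block_start ns"
    unfolding n by (rule block_cycles_list[OF ns])
  have starts: "card starts = m"
    using card_block_start_fixed[of ns] ns assms(2) unfolding starts_def by (force simp: n)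
  \<comment> \<open>The block of size above 2 makes the inequality strict, as the lower bound
    requires.\<close>
  have "(\<Sum>i<m. 2) < (\<Sum>i<m. ns ! i)"
    using assms(3,6) by (intro sum_strict_mono_ex1) auto
  then have "2 * m < n"
    using assms(5) by simp
  then have mn: "n \<ge> 4" "m < n div 2"
    using assms(1) even_n by (auto elim!: evenE)
  have ones: "ones M = {(i, j). i < n \<and> j < n \<and> entry i j}"
    using ns by (auto simp: ones_def assms(4) complement_mat_def dim_circulant_block_diag n
        circulant_block_diag_entry entry_def)
  have lower: "n - m + 1 \<le> card P"
    if "finite P" "partition_on (ones M) P" "\<forall>S\<in>P. comb_rectangle M S" for P
    using card_gt_of_partition[of P] that mn starts unfolding ones
    by (fastforce simp: comb_rectangle_def)
  obtain P where P: "finite P" "card P \<le> n - m + 1" "partition_on (ones M) P"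
    "\<forall>S\<in>P. \<exists>R C. S = R \<times> C"
    using ex_rectangle_partition mn unfolding ones starts by auto
  have rect: "\<forall>S\<in>P. comb_rectangle M S"
  proof
    fix S assume S: "S \<in> P"
    then obtain R C where "S = R \<times> C" using P(4) by blast
    moreover have "S \<noteq> {}" "S \<subseteq> ones M"
      using S partition_onD1[OF P(3)] partition_onD3[OF P(3)] by auto
    ultimately show "comb_rectangle M S"
      using comb_rectangle_Times by metis
  qed
  have "binary_rank M = n - m + 1"
    unfolding binary_rank_def
  proof (rule Least_equality)
    \<comment> \<open>The construction gives at most this many parts, and the lower bound forces
      equality.\<close>
    have "card P = n - m + 1"
      using lower[OF P(1,3) rect] P(2) by simp
    then show "\<exists>P. finite P \<and> card P = n - m + 1 \<and> partition_on (ones M) P \<and>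
        (\<forall>S\<in>P. comb_rectangle M S)"
      using P(1,3) rect by blast
  qed (use lower in blast)
  then show ?thesis
    using mn by simp
qed

end
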